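(* Let $T$ be a finite tree with at least one edge, let $v\in V(T)$, and let $d=d_T(v)$. For each integer $k\ge 0$ let $T_k$ be the tree obtained from $T$ by attaching $k$ additional pendant edges at $v$, and let $\lambda_k=\lambda_{\max}(R_{T_k})$ be the largest eigenvalue of the Ricci matrix of $T_k$. Let $A_1,\dots,A_d$ be the branch matrices of $T$ at $v$ and let $Q_\infty$ be the limit matrix of $(T,v)$ (both defined in the context). Then, as $k\to\infty$, $$\lambda_k\longrightarrow \lambda_\infty:=\lambda_{\max}(Q_\infty)=\max\bigl(0,\lambda_{\max}(A_1),\dots,\lambda_{\max}(A_d)\bigr).$$
   Context: For a finite tree $T=(V,E)$ with at least one edge, $d_x=d_T(x)$ denotes the degree of a vertex $x$. The Ricci matrix $R_T\in\mathbb{R}^{E\times E}$ is the symmetric matrix with entries $(R_T)_{e,e}=-\bigl(\frac1{d_x}+\frac1{d_y}\bigr)$ for $e=\{x,y\}$; $(R_T)_{e,e'}=\frac1{d_z}$ if $e\ne e'$ and $e\cap e'=\{z\}$; $(R_T)_{e,e'}=0$ if $e\cap e'=\varnothing$. $\lambda_{\max}$ denotes the largest eigenvalue of a matrix all of whose eigenvalues are real. A pendant edge attached at $v$ is an edge $\{v,u\}$ where $u$ is a new vertex of degree $1$. Branches at $v$: let $u_1,\dots,u_d$ be the neighbors of $v$ in $T$, let $e_j=\{v,u_j\}$ (the root edges), and let $C_j$ be the connected component of $T-v$ containing $u_j$. The $j$-th branch edge set is $E_j=\{e_j\}\cup E(C_j)$; thus $E(T)=E_1\sqcup\dots\sqcup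 E_d$. The branch matrix $A_j\in\mathbb{R}^{E_j\times E_j}$ is obtained from the block of $R_T$ indexed by $E_j$ by replacing $1/d_T(v)$ by $0$: its entry at $(e_j,e_j)$ is $-1/d_T(u_j)$, and all its other entries equal the corresponding entries of $R_T$ (with degrees taken in $T$). Limit matrix: $Q_\infty$ is the square matrix indexed by $E(T)\sqcup\{y\}$, where $y$ is one extra index, with entries: $(Q_\infty)_{e,e'}=(A_j)_{e,e'}$ if $e,e'\in E_j$ for the same $j$; $(Q_\infty)_{e_j,y}=1$ for $j=1,\dots,d$; all other entries are $0$ (in particular the row indexed by $y$ is zero). *)

theory Defs
  imports Complex_Main "Jordan_Normal_Form.Spectral_Radius"
begin

section \<open>Simple graphs and trees\<close>

text \<open>
  The predicate \<open>tree\<close> of the entry \<open>Graph_Theory\<close> is not used: it excludes directed cycles only,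
  so a transitive triangle satisfies it, while the symmetric digraph of an undirected tree with an
  edge does not (a pair of opposite arcs is a directed cycle).  Edges are two-element vertex sets.
\<close>

record 'a ugraph =
  verts :: "'a set"
  edges :: "'a set set"

definition finite_simple_graph :: "'a ugraph \<Rightarrow> bool" where
  "finite_simple_graph G \<longleftrightarrow>
     finite (verts G) \<and> (\<forall>e\<in>edges G. \<exists>x\<in>verts G. \<exists>y\<in>verts G. x \<noteq> y \<and> e = {x, y})"

definition adj :: "'a ugraph \<Rightarrow> 'a \<Rightarrow> 'a \<Rightarrow> bool" where
  "adj G x y \<longleftrightarrow> {x, y} \<in> edges G"

definition component :: "'a ugraph \<Rightarrow> 'a \<Rightarrow> 'a set" where
  "component G u = {w \<in> verts G. (adj G)\<^sup>*\<^sup>* u w}"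

definition connected_graph :: "'a ugraph \<Rightarrow> bool" where
  "connected_graph G \<longleftrightarrow> verts G \<noteq> {} \<and> (\<forall>u\<in>verts G. component G u = verts G)"

definition cycle :: "'a ugraph \<Rightarrow> 'a list \<Rightarrow> bool" where
  "cycle G c \<longleftrightarrow>
     length c \<ge> 3 \<and> distinct c \<and> successively (adj G) c \<and> adj G (last c) (hd c)"

definition finite_tree :: "'a ugraph \<Rightarrow> bool" where
  "finite_tree G \<longleftrightarrow> finite_simple_graph G \<and> connected_graph G \<and> \<not> (\<exists>c. cycle G c)"

definition neighbors :: "'a ugraph \<Rightarrow> 'a \<Rightarrow> 'a set" where
  "neighbors G v = {u \<in> verts G. adj G v u}"

definition degree :: "'a ugraph \<Rightarrow> 'a \<Rightarrow> nat" where
  "degree G x = card (neighbors G x)"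

definition del_vert :: "'a ugraph \<Rightarrow> 'a \<Rightarrow> 'a ugraph" where
  "del_vert G v = \<lparr> verts = verts G - {v}, edges = {e \<in> edges G. v \<notin> e} \<rparr>"

text \<open>The old vertices are tagged with \<^const>\<open>Inl\<close>; the new leaves are \<open>Inr 0, \<dots>, Inr (k - 1)\<close>.\<close>

definition attach_pendants :: "'a ugraph \<Rightarrow> 'a \<Rightarrow> nat \<Rightarrow> ('a + nat) ugraph" where
  "attach_pendants G v k =
     \<lparr> verts = Inl ` verts G \<union> Inr ` {..<k},
       edges = (\<lambda>e. Inl ` e) ` edges G \<union> (\<lambda>i. {Inl v, Inr i}) ` {..<k} \<rparr>"

section \<open>Square matrices indexed by a finite set\<close>

text \<open>
  A matrix indexed by the finite set \<open>I\<close> is given by a function \<open>M\<close>, of which only the values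
  on \<open>I \<times> I\<close> matter.  It becomes a library matrix through some enumeration of \<open>I\<close>; by the
  lemma below its eigenvalues do not depend on which one.
\<close>

definition matrix_on :: "'i set \<Rightarrow> ('i \<Rightarrow> 'i \<Rightarrow> real) \<Rightarrow> real mat" where
  "matrix_on I M =
     (let is = (SOME is. distinct is \<and> set is = I)
      in mat (length is) (length is) (\<lambda>(i, j). M (is ! i) (is ! j)))"

lemma eigenvalue_matrix_on_iff:
  assumes "finite I"
  shows "eigenvalue (matrix_on I M) c \<longleftrightarrow>
    (\<exists>x. (\<exists>i\<in>I. x i \<noteq> 0) \<and> (\<forall>i\<in>I. (\<Sum>j\<in>I. M i j * x j) = c * x i))"
proof -
  define xs where "xs = (SOME xs. distinct xs \<and> set xs = I)"
  have "\<exists>xs. distinct xs \<and> set xs = I"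
    using finite_distinct_list[OF assms] by blast
  then have "distinct xs \<and> set xs = I"
    unfolding xs_def by (rule someI_ex)
  then have d: "distinct xs" and s: "set xs = I" by auto
  let ?n = "length xs"
  let ?A = "matrix_on I M"
  have A: "?A = mat ?n ?n (\<lambda>(i, j). M (xs ! i) (xs ! j))"
    by (simp add: matrix_on_def xs_def Let_def)
  have bij: "bij_betw ((!) xs) {0..<?n} I"
    using d s by (metis atLeast0LessThan bij_betw_nth)
  have sum: "(\<Sum>j\<in>I. f j) = (\<Sum>j = 0..<?n. f (xs ! j))" for f :: "_ \<Rightarrow> real"
    by (rule sum.reindex_bij_betw[OF bij, symmetric])
  have I_all: "(\<forall>i\<in>I. P i) \<longleftrightarrow> (\<forall>i<?n. P (xs ! i))" for P
    using s by (metis in_set_conv_nth)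
  have I_ex: "(\<exists>i\<in>I. P i) \<longleftrightarrow> (\<exists>i<?n. P (xs ! i))" for P
    using s by (metis in_set_conv_nth)
  have ev: "eigenvector ?A v c \<longleftrightarrow> (\<exists>i<?n. v $ i \<noteq> 0) \<and>
      (\<forall>i<?n. (\<Sum>j = 0..<?n. M (xs ! i) (xs ! j) * v $ j) = c * v $ i)"
    if v: "v \<in> carrier_vec ?n" for v
    using v by (auto simp: A eigenvector_def vec_eq_iff scalar_prod_def)
  show ?thesis
  proof
    assume "eigenvalue ?A c"
    then obtain v where e: "eigenvector ?A v c" by (auto simp: eigenvalue_def)
    then have v: "v \<in> carrier_vec ?n" by (simp add: eigenvector_def A)
    define g where "g = the_inv_into {0..<?n} ((!) xs)"
    have g: "g (xs ! i) = i" if "i < ?n" for i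
      using that bij by (auto simp: g_def bij_betw_def intro: the_inv_into_f_f)
    from e[unfolded ev[OF v]]
    show "\<exists>x. (\<exists>i\<in>I. x i \<noteq> 0) \<and> (\<forall>i\<in>I. (\<Sum>j\<in>I. M i j * x j) = c * x i)"
      unfolding I_all I_ex sum
      by (intro exI[of _ "\<lambda>i. v $ g i"]) (auto simp: g)
  next
    assume "\<exists>x. (\<exists>i\<in>I. x i \<noteq> 0) \<and> (\<forall>i\<in>I. (\<Sum>j\<in>I. M i j * x j) = c * x i)"
    then obtain x where "(\<exists>i\<in>I. x i \<noteq> 0) \<and> (\<forall>i\<in>I. (\<Sum>j\<in>I. M i j * x j) = c * x i)" by blast
    then have "eigenvector ?A (vec ?n (\<lambda>i. x (xs ! i))) c"
      unfolding I_all I_ex sum by (subst ev) auto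
    then show "eigenvalue ?A c" by (auto simp: eigenvalue_def)
  qed
qed

text \<open>
  The largest eigenvalue, intended for matrices with \<open>real_spectrum\<close> (symmetric ones, for
  instance); in general it would be the largest real eigenvalue.
\<close>

definition lambda_max :: "real mat \<Rightarrow> real" where
  "lambda_max A = Max (spectrum A)"

definition real_spectrum :: "real mat \<Rightarrow> bool" where
  "real_spectrum A \<longleftrightarrow> spectrum (map_mat complex_of_real A) \<subseteq> \<real>"

section \<open>Ricci, branch and limit matrices\<close>

definition ricci_entry :: "'a ugraph \<Rightarrow> 'a set \<Rightarrow> 'a set \<Rightarrow> real" where
  "ricci_entry T e e' =
     (if e = e' then - (\<Sum>x\<in>e. 1 / real (degree T x))
      else if e \<inter> e' = {} then 0
      else 1 / real (degree T (the_elem (e \<inter> e'))))"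

definition ricci_matrix :: "'a ugraph \<Rightarrow> real mat" where
  "ricci_matrix T = matrix_on (edges T) (ricci_entry T)"

text \<open>The branches at \<open>v\<close> are indexed by the neighbours \<open>u\<close> of \<open>v\<close> rather than by \<open>1, \<dots>, d\<close>.\<close>

definition branch_edges :: "'a ugraph \<Rightarrow> 'a \<Rightarrow> 'a \<Rightarrow> 'a set set" where
  "branch_edges T v u =
     insert {v, u} {e \<in> edges (del_vert T v). e \<subseteq> component (del_vert T v) u}"

definition branch_entry :: "'a ugraph \<Rightarrow> 'a \<Rightarrow> 'a \<Rightarrow> 'a set \<Rightarrow> 'a set \<Rightarrow> real" where
  "branch_entry T v u e e' =
     (if e = {v, u} \<and> e' = {v, u} then - (1 / real (degree T u)) else ricci_entry T e e')"

definition branch_matrix :: "'a ugraph \<Rightarrow> 'a \<Rightarrow> 'a \<Rightarrow> real mat" where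
  "branch_matrix T v u = matrix_on (branch_edges T v u) (branch_entry T v u)"

text \<open>
  The index set of the limit matrix is \<open>Some ` edges T \<union> {None}\<close>, the extra index being \<^const>\<open>None\<close>.
  In a tree every edge lies in exactly one branch, so the description below is well defined.
\<close>

fun limit_entry :: "'a ugraph \<Rightarrow> 'a \<Rightarrow> 'a set option \<Rightarrow> 'a set option \<Rightarrow> real" where
  "limit_entry T v (Some e) (Some e') =
     (if \<exists>u\<in>neighbors T v. e \<in> branch_edges T v u \<and> e' \<in> branch_edges T v u
      then branch_entry T v
             (THE u. u \<in> neighbors T v \<and> e \<in> branch_edges T v u \<and> e' \<in> branch_edges T v u) e e'
      else 0)"
| "limit_entry T v (Some e) None = (if \<exists>u\<in>neighbors T v. e = {v, u} then 1 else 0)"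
| "limit_entry T v None _ = 0"

definition limit_matrix :: "'a ugraph \<Rightarrow> 'a \<Rightarrow> real mat" where
  "limit_matrix T v = matrix_on (insert None (Some ` edges T)) (limit_entry T v)"

end

theory Submission
  imports Defs "HOL-Analysis.Function_Topology" "HOL-Analysis.Convex"
    "HOL-Real_Asymp.Real_Asymp"
begin

text \<open>
  Let \<open>A\<close> be the direct sum of the branch matrices and \<open>n = d + k\<close> the degree of \<open>v\<close> in \<open>T\<^sub>k\<close>.  On a
  vector with entries \<open>f\<close> on \<open>E(T)\<close> and \<open>g\<close> on the pendant edges, the quadratic form of \<open>R\<close> is
  \<open>\<langle>f, A f\<rangle> + ((s + G)\<^sup>2 - 2 \<Sum>\<^sub>j f(e\<^sub>j)\<^sup>2) / n - (1 + 2 / n) |g|\<^sup>2\<close>, where \<open>s\<close> is the sum of \<open>f\<close> over the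
  root edges \<open>e\<^sub>j\<close> and \<open>G\<close> the sum of all entries of \<open>g\<close>.  An eigenvector of \<open>A\<close> and the indicator
  of the pendant edges, used as test vectors, bound \<open>\<lambda>\<^sub>k\<close> from below by \<open>\<lambda>\<^sub>\<infinity> - (d + 2) / n\<close>.  From
  above, \<open>(s + G)\<^sup>2 \<le> (1 + 1/\<epsilon>) s\<^sup>2 + (1 + \<epsilon>) G\<^sup>2\<close> and \<open>G\<^sup>2 \<le> n |g|\<^sup>2\<close> give
  \<open>\<lambda>\<^sub>k \<le> \<lambda>\<^sub>\<infinity> + \<epsilon> + (1 + 1/\<epsilon>) |E(T)| / n\<close>, and \<open>\<epsilon> = 1 / sqrt k\<close> closes the gap.  The limit matrix
  is block triangular with diagonal blocks \<open>A\<close> and \<open>0\<close>.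
\<close>

section \<open>Largest eigenvalues of symmetric matrices\<close>

text \<open>\<open>lambda_max\<close> is a \<open>Max\<close>, so it says something only for a
  finite nonempty spectrum. Finiteness holds for every square matrix; nonemptiness is not automatic
  over the reals and comes from the given eigenvalue \<open>c\<close>.\<close>

lemma
  assumes "finite I" and "eigenvalue (matrix_on I M) c"
  shows eigenvalue_le_lambda_max: "c \<le> lambda_max (matrix_on I M)"
    and eigenvalue_lambda_max: "eigenvalue (matrix_on I M) (lambda_max (matrix_on I M))"
proof -
  have "finite (spectrum (matrix_on I M))"
    by (rule card_finite_spectrum(1)) (auto simp: matrix_on_def Let_def)
  moreover have "c \<in> spectrum (matrix_on I M)"
    using assms by (simp add: spectrum_def)
  ultimately show "c \<le> lambda_max (matrix_on I M)"
    and "eigenvalue (matrix_on I M) (lambda_max (matrix_on I M))"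
    using Max_in[of "spectrum (matrix_on I M)"]
    by (auto simp: lambda_max_def spectrum_def)
qed

text \<open>A continuous function on the compact unit sphere has a maximum, and homogeneity of
  degree two carries the bound from unit vectors to all \<open>y\<close>.\<close>

lemma quadratic_form_attains_max:
  fixes M :: "'i \<Rightarrow> 'i \<Rightarrow> real"
  assumes fin: "finite I" and ne: "I \<noteq> {}"
  shows "\<exists>x. (\<Sum>i\<in>I. (x i)\<^sup>2) = 1 \<and>
    (\<forall>y. (\<Sum>i\<in>I. \<Sum>j\<in>I. M i j * y i * y j) \<le>
      (\<Sum>i\<in>I. \<Sum>j\<in>I. M i j * x i * x j) * (\<Sum>i\<in>I. (y i)\<^sup>2))"
proof -
  define q where "q y = (\<Sum>i\<in>I. \<Sum>j\<in>I. M i j * y i * y j)" for y :: "'i \<Rightarrow> real"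
  \<comment> \<open>Vectors are functions on the whole index type, where the unit sphere over
    \<open>I\<close> is not compact. Fixing the coordinates outside \<open>I\<close> at 0 makes
    \<open>K\<close> a product of compact sets, hence compact by Tychonoff.\<close>
  define K where "K = (\<Pi>\<^sub>E i\<in>UNIV. if i \<in> I then {-1..1::real} else {0})"
  have "compactin (product_topology (\<lambda>_. euclidean) UNIV) K"
    unfolding K_def compactin_PiE by auto
  then have "compact K"
    by (simp add: euclidean_product_topology)
  moreover have cont: "continuous_on A (\<lambda>x. x i)" for A and i :: 'i and x :: "'i \<Rightarrow> real"
    by (rule continuous_on_subset[OF continuous_on_product_coordinates]) auto
  have "closed {x :: 'i \<Rightarrow> real. (\<Sum>i\<in>I. (x i)\<^sup>2) = 1}"
    by (intro closed_Collect_eq continuous_intros cont)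
  ultimately have comp: "compact (K \<inter> {x. (\<Sum>i\<in>I. (x i)\<^sup>2) = 1})"
    by (rule compact_Int_closed)
  obtain i0 where "i0 \<in> I" using ne by auto
  then have "(\<lambda>i. if i = i0 then 1 else 0) \<in> K \<inter> {x. (\<Sum>i\<in>I. (x i)\<^sup>2) = 1}"
    using fin by (auto simp: K_def if_distrib[of "\<lambda>t. t\<^sup>2"] cong: if_cong)
  moreover have "continuous_on (K \<inter> {x. (\<Sum>i\<in>I. (x i)\<^sup>2) = 1}) q"
    unfolding q_def by (intro continuous_intros cont)
  ultimately obtain x where x: "(\<Sum>i\<in>I. (x i)\<^sup>2) = 1"
    and mx: "\<And>y. y \<in> K \<Longrightarrow> (\<Sum>i\<in>I. (y i)\<^sup>2) = 1 \<Longrightarrow> q y \<le> q x"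
    using continuous_attains_sup[OF comp, of q] by blast
  have "q y \<le> q x * (\<Sum>i\<in>I. (y i)\<^sup>2)" for y
  proof (cases "(\<Sum>i\<in>I. (y i)\<^sup>2) = 0")
    case True
    then have "\<forall>i\<in>I. y i = 0"
      using fin by (simp add: sum_nonneg_eq_0_iff)
    then show ?thesis by (simp add: q_def)
  next
    case False
    define S where "S = (\<Sum>i\<in>I. (y i)\<^sup>2)"
    have S: "S > 0"
      using False sum_nonneg[of I "\<lambda>i. (y i)\<^sup>2"] by (simp add: S_def)
    \<comment> \<open>Normalization must also reset the entries outside \<open>I\<close>, since
      otherwise \<open>z\<close> need not lie in \<open>K\<close>.\<close>
    define z where "z i = (if i \<in> I then y i / sqrt S else 0)" for i
    have z2: "(\<Sum>i\<in>I. (z i)\<^sup>2) = 1"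
    proof -
      have "(\<Sum>i\<in>I. (z i)\<^sup>2) = (\<Sum>i\<in>I. (y i)\<^sup>2 / S)"
        using S by (intro sum.cong) (auto simp: z_def power_divide)
      also have "\<dots> = 1"
        using S by (simp add: sum_divide_distrib[symmetric] S_def[symmetric])
      finally show ?thesis .
    qed
    have "\<bar>z i\<bar> \<le> 1" if "i \<in> I" for i
    proof -
      have "(z i)\<^sup>2 \<le> (\<Sum>i\<in>I. (z i)\<^sup>2)"
        using that fin by (intro member_le_sum) auto
      then show ?thesis using z2 by (simp add: abs_square_le_1)
    qed
    then have "z i \<in> (if i \<in> I then {-1..1} else {0})" for i
      by (cases "i \<in> I") (force simp: abs_le_iff, simp add: z_def)
    then have "z \<in> K"
      by (simp add: K_def PiE_def)
    then have "q z \<le> q x" using z2 mx by blast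
    moreover have "q z = q y / S"
    proof -
      have "M i j * z i * z j = M i j * y i * y j / S" if "i \<in> I" "j \<in> I" for i j
        using that S by (simp add: z_def field_simps)
      then show ?thesis
        by (simp add: q_def sum_divide_distrib)
    qed
    ultimately show ?thesis
      using S by (simp add: S_def[symmetric] field_simps)
  qed
  then show ?thesis
    using x unfolding q_def by blast
qed

text \<open>The first-order condition at a maximum: for small \<open>t\<close> of the sign of
  \<open>a\<close> the linear term would win.\<close>

lemma linear_le_quadratic_imp_zero:
  fixes a b :: real
  assumes "\<And>t. t * a \<le> t\<^sup>2 * b"
  shows "a = 0"
proof (rule ccontr)
  assume a: "a \<noteq> 0"
  \<comment> \<open>This \<open>t\<close> has the sign of \<open>a\<close> and satisfies |t b| <
    |a|, so the line lies strictly above the parabola at \<open>t\<close>.\<close>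
  define t where "t = a / (\<bar>b\<bar> + 1)"
  have "t * a = a\<^sup>2 / (\<bar>b\<bar> + 1)" by (simp add: t_def power2_eq_square)
  moreover have "t\<^sup>2 * b = a\<^sup>2 / (\<bar>b\<bar> + 1) * (b / (\<bar>b\<bar> + 1))"
    by (simp add: t_def power2_eq_square)
  moreover have "b / (\<bar>b\<bar> + 1) < 1" by (simp add: field_simps)
  moreover have "a\<^sup>2 / (\<bar>b\<bar> + 1) > 0" using a by (simp add: field_simps)
  ultimately show False
    using assms[of t] by (smt (verit) mult_less_cancel_left2)
qed

text \<open>A maximizer of the Rayleigh quotient is an eigenvector, its eigenvalue being the
  maximum: the first variation along each coordinate vanishes. Symmetry makes the two cross terms of
  the variation equal.\<close>

lemma rayleigh_eigenvalue:
  fixes M :: "'i \<Rightarrow> 'i \<Rightarrow> real"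
  assumes fin: "finite I" and ne: "I \<noteq> {}"
    and sym: "\<And>i j. i \<in> I \<Longrightarrow> j \<in> I \<Longrightarrow> M i j = M j i"
  shows "\<exists>c. eigenvalue (matrix_on I M) c \<and>
    (\<forall>y. (\<Sum>i\<in>I. \<Sum>j\<in>I. M i j * y i * y j) \<le> c * (\<Sum>i\<in>I. (y i)\<^sup>2))"
proof -
  define q where "q y = (\<Sum>i\<in>I. \<Sum>j\<in>I. M i j * y i * y j)" for y :: "'i \<Rightarrow> real"
  obtain x where x: "(\<Sum>i\<in>I. (x i)\<^sup>2) = 1"
    and mx: "\<And>y. q y \<le> q x * (\<Sum>i\<in>I. (y i)\<^sup>2)"
    using quadratic_form_attains_max[OF fin ne, of M] unfolding q_def by blast
  have "(\<Sum>j\<in>I. M i j * x j) = q x * x i" if i: "i \<in> I" for i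
  proof -
    define r where "r = (\<Sum>j\<in>I. M i j * x j)"
    define e where "e = (\<lambda>j. if j = i then 1 else 0 :: real)"
    \<comment> \<open>Maximality is applied to x + t e, where the form is q x + 2 t r + t^2 M i i
      and the squared norm is 1 + 2 t x i + t^2.\<close>
    have "t * (2 * (r - q x * x i)) \<le> t\<^sup>2 * (q x - M i i)" for t
    proof -
      have e1: "(\<Sum>j\<in>I. f j * e j) = f i" for f
        using fin i by (simp add: e_def if_distrib[of "(*) _"] cong: if_cong)
      have e2: "(\<Sum>j\<in>I. f j * (e j * e j)) = f i" for f
        using fin i by (simp add: e_def if_distrib[of "(*) _"] cong: if_cong)
      have "(\<Sum>j\<in>I. (x j + t * e j)\<^sup>2) =
          (\<Sum>j\<in>I. (x j)\<^sup>2) + 2 * t * (\<Sum>j\<in>I. x j * e j) + t\<^sup>2 * (\<Sum>j\<in>I. 1 * (e j * e j))"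
        unfolding sum_distrib_left sum.distrib[symmetric]
        by (intro sum.cong) (auto simp: power2_eq_square algebra_simps)
      then have n: "(\<Sum>j\<in>I. (x j + t * e j)\<^sup>2) = 1 + 2 * t * x i + t\<^sup>2"
        unfolding e1 e2 x by simp
      have r': "(\<Sum>j\<in>I. M j i * x j) = r"
        unfolding r_def using sym i by (intro sum.cong) auto
      have "q (\<lambda>j. x j + t * e j) = q x
          + t * (\<Sum>k\<in>I. (\<Sum>j\<in>I. M k j * x j) * e k)
          + t * (\<Sum>k\<in>I. (\<Sum>j\<in>I. (M k j * x k) * e j))
          + t\<^sup>2 * (\<Sum>k\<in>I. (\<Sum>j\<in>I. M k j * e j) * e k)"
        unfolding q_def sum_distrib_left sum_distrib_right sum.distrib[symmetric]
        by (intro sum.cong) (auto simp: power2_eq_square algebra_simps)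
      then have "q (\<lambda>j. x j + t * e j) = q x + 2 * t * r + t\<^sup>2 * M i i"
        unfolding e1 r' r_def[symmetric] by simp
      then show ?thesis
        using mx[of "\<lambda>j. x j + t * e j"] n by (simp add: algebra_simps)
    qed
    then have "2 * (r - q x * x i) = 0" by (rule linear_le_quadratic_imp_zero)
    then show ?thesis by (simp add: r_def)
  qed
  moreover have "\<exists>i\<in>I. x i \<noteq> 0"
    using x by (metis (no_types, lifting) sum.neutral zero_neq_one zero_power2)
  ultimately have "eigenvalue (matrix_on I M) (q x)"
    using fin by (auto simp: eigenvalue_matrix_on_iff)
  then show ?thesis
    using mx unfolding q_def by blast
qed

lemma quadratic_form_le_lambda_max:
  fixes M :: "'i \<Rightarrow> 'i \<Rightarrow> real"
  assumes "finite I" and "I \<noteq> {}"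
    and "\<And>i j. i \<in> I \<Longrightarrow> j \<in> I \<Longrightarrow> M i j = M j i"
  shows "(\<Sum>i\<in>I. \<Sum>j\<in>I. M i j * y i * y j) \<le>
    lambda_max (matrix_on I M) * (\<Sum>i\<in>I. (y i)\<^sup>2)"
proof -
  obtain c where c: "eigenvalue (matrix_on I M) c"
    and le: "(\<Sum>i\<in>I. \<Sum>j\<in>I. M i j * y i * y j) \<le> c * (\<Sum>i\<in>I. (y i)\<^sup>2)"
    using rayleigh_eigenvalue[of I M] assms by blast
  have "c * (\<Sum>i\<in>I. (y i)\<^sup>2) \<le> lambda_max (matrix_on I M) * (\<Sum>i\<in>I. (y i)\<^sup>2)"
    using eigenvalue_le_lambda_max[OF assms(1) c] by (intro mult_right_mono sum_nonneg) auto
  with le show ?thesis by linarith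
qed

lemma lambda_max_is_eigenvalue_of_symmetric:
  fixes M :: "'i \<Rightarrow> 'i \<Rightarrow> real"
  assumes "finite I" and "I \<noteq> {}"
    and "\<And>i j. i \<in> I \<Longrightarrow> j \<in> I \<Longrightarrow> M i j = M j i"
  shows "eigenvalue (matrix_on I M) (lambda_max (matrix_on I M))"
  using rayleigh_eigenvalue[of I M] assms eigenvalue_lambda_max by blast

lemma quadratic_form_eigenvector:
  fixes M :: "'i \<Rightarrow> 'i \<Rightarrow> real"
  assumes "\<And>i. i \<in> I \<Longrightarrow> (\<Sum>j\<in>I. M i j * x j) = c * x i"
  shows "(\<Sum>i\<in>I. \<Sum>j\<in>I. M i j * x i * x j) = c * (\<Sum>i\<in>I. (x i)\<^sup>2)"
proof -
  have "(\<Sum>j\<in>I. M i j * x i * x j) = c * (x i)\<^sup>2" if "i \<in> I" for i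
  proof -
    have "(\<Sum>j\<in>I. M i j * x i * x j) = x i * (\<Sum>j\<in>I. M i j * x j)"
      by (simp add: sum_distrib_left algebra_simps)
    then show ?thesis using assms[OF that] by (simp add: power2_eq_square)
  qed
  then show ?thesis by (simp add: sum_distrib_left)
qed

section \<open>Complex eigenvalues of symmetric matrices, and matrices with a zero row\<close>

text \<open>\<open>real_spectrum\<close> speaks of complex eigenvalues, so eigenvectors in
  coordinates are wanted over the complex numbers too; only the passage from an eigenvalue to a
  vector matters.\<close>

lemma complex_eigenvalue_matrix_on:
  assumes "finite I" and e: "eigenvalue (map_mat complex_of_real (matrix_on I M)) c"
  shows "\<exists>x. (\<exists>i\<in>I. x i \<noteq> 0) \<and> (\<forall>i\<in>I. (\<Sum>j\<in>I. of_real (M i j) * x j) = c * x i)"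
proof -
  define xs where "xs = (SOME xs. distinct xs \<and> set xs = I)"
  have "\<exists>xs. distinct xs \<and> set xs = I"
    using finite_distinct_list[OF assms(1)] by blast
  then have "distinct xs \<and> set xs = I"
    unfolding xs_def by (rule someI_ex)
  then have d: "distinct xs" and s: "set xs = I" by auto
  let ?n = "length xs"
  have A: "matrix_on I M = mat ?n ?n (\<lambda>(i, j). M (xs ! i) (xs ! j))"
    by (simp add: matrix_on_def xs_def Let_def)
  have bij: "bij_betw ((!) xs) {0..<?n} I"
    using d s by (metis atLeast0LessThan bij_betw_nth)
  let ?A = "map_mat complex_of_real (matrix_on I M)"
  obtain w where "eigenvector ?A w c"
    using e unfolding eigenvalue_def by blast
  then have w: "w \<in> carrier_vec ?n" "w \<noteq> 0\<^sub>v ?n" "?A *\<^sub>v w = c \<cdot>\<^sub>v w"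
    by (simp_all add: A eigenvector_def)
  have nz: "\<exists>i<?n. w $ i \<noteq> 0"
  proof (rule ccontr)
    assume "\<not> ?thesis"
    then have "w = 0\<^sub>v ?n" using w(1) by (intro eq_vecI) auto
    with w(2) show False by simp
  qed
  have eq: "(\<Sum>j = 0..<?n. of_real (M (xs ! i) (xs ! j)) * w $ j) = c * w $ i" if "i < ?n" for i
    using arg_cong[OF w(3), of "\<lambda>u. u $ i"] w(1) that by (simp add: A scalar_prod_def)
  define x where "x i = w $ the_inv_into {0..<?n} ((!) xs) i" for i
  have x: "x (xs ! i) = w $ i" if "i < ?n" for i
    using that bij by (auto simp: x_def bij_betw_def the_inv_into_f_f)
  show ?thesis
  proof (intro exI[of _ x] conjI ballI)
    show "\<exists>i\<in>I. x i \<noteq> 0"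
    proof -
      obtain i where i: "i < ?n" "w $ i \<noteq> 0" using nz by blast
      then have "xs ! i \<in> I" "x (xs ! i) \<noteq> 0" using s x by auto
      then show ?thesis by blast
    qed
    show "(\<Sum>j\<in>I. of_real (M i j) * x j) = c * x i" if "i \<in> I" for i
    proof -
      obtain k where k: "k < ?n" "i = xs ! k"
        using \<open>i \<in> I\<close> unfolding s[symmetric] in_set_conv_nth by blast
      show ?thesis
        unfolding sum.reindex_bij_betw[OF bij, symmetric] using eq[OF k(1)] by (simp add: k x)
    qed
  qed
qed

text \<open>The Hermitian form \<open>p\<close> of the eigenvector equals \<open>c\<close> times its
  squared norm \<open>S\<close>. Symmetry makes \<open>p\<close> its own conjugate, and
  \<open>S\<close> is real and nonzero.\<close>

lemma symmetric_eigenvalue_real: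
  fixes M :: "'i \<Rightarrow> 'i \<Rightarrow> real" and x :: "'i \<Rightarrow> complex"
  assumes fin: "finite I" and sym: "\<And>i j. i \<in> I \<Longrightarrow> j \<in> I \<Longrightarrow> M i j = M j i"
    and nz: "\<exists>i\<in>I. x i \<noteq> 0"
    and eq: "\<And>i. i \<in> I \<Longrightarrow> (\<Sum>j\<in>I. of_real (M i j) * x j) = c * x i"
  shows "c \<in> \<real>"
proof -
  define p where "p = (\<Sum>i\<in>I. \<Sum>j\<in>I. of_real (M i j) * (cnj (x i) * x j))"
  define S where "S = (\<Sum>i\<in>I. (cmod (x i))\<^sup>2)"
  have "p = (\<Sum>i\<in>I. cnj (x i) * (\<Sum>j\<in>I. of_real (M i j) * x j))"
    by (simp add: p_def sum_distrib_left algebra_simps)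
  also have "\<dots> = (\<Sum>i\<in>I. c * of_real ((cmod (x i))\<^sup>2))"
    by (intro sum.cong) (simp_all add: eq complex_norm_square mult.left_commute mult.commute[of "cnj _"]
      del: of_real_power)
  finally have p: "p = c * of_real S" by (simp add: S_def sum_distrib_left)
  have "cnj p = (\<Sum>i\<in>I. \<Sum>j\<in>I. of_real (M i j) * (cnj (x j) * x i))"
    by (simp add: p_def algebra_simps)
  also have "\<dots> = (\<Sum>j\<in>I. \<Sum>i\<in>I. of_real (M i j) * (cnj (x j) * x i))"
    by (rule sum.swap)
  also have "\<dots> = p"
    unfolding p_def using sym by (intro sum.cong) auto
  finally have "cnj p = p" .
  moreover have "S \<noteq> 0"
    using nz fin by (auto simp: S_def sum_nonneg_eq_0_iff)
  ultimately have "cnj c = c" unfolding p by auto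
  then show ?thesis by (simp add: Reals_cnj_iff)
qed

text \<open>The transpose has a zero column, so the indicator of \<open>k\<close> lies in its
  kernel; a matrix and its transpose share their characteristic polynomial.\<close>

lemma zero_row_eigenvalue:
  assumes fin: "finite I" and k: "k \<in> I" and zero: "\<And>j. j \<in> I \<Longrightarrow> M k j = 0"
  shows "eigenvalue (matrix_on I M) 0"
proof -
  let ?A = "matrix_on I M"
  define n where "n = dim_row ?A"
  have A: "?A \<in> carrier_mat n n" by (auto simp: matrix_on_def Let_def n_def)
  have tr: "transpose_mat ?A = matrix_on I (\<lambda>i j. M j i)"
    by (rule eq_matI) (auto simp: matrix_on_def Let_def)
  have "eigenvalue (matrix_on I (\<lambda>i j. M j i)) 0"
    unfolding eigenvalue_matrix_on_iff[OF fin]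
    using fin k zero by (intro exI[of _ "\<lambda>i. if i = k then 1 else 0"])
      (auto simp: if_distrib[of "(*) _"] cong: if_cong)
  then have "poly (char_poly (transpose_mat ?A)) 0 = 0"
    using A unfolding tr[symmetric] by (subst (asm) eigenvalue_root_char_poly[of _ n]) auto
  then show ?thesis
    using A by (simp add: eigenvalue_root_char_poly)
qed

section \<open>Branches and pendant edges\<close>

text \<open>The path is built from its front. If the new start already lies on the path, the loop is
  cut off by keeping only the part from that vertex on. The last clause serves to show that paths in
  T - v avoid v.\<close>

lemma rtranclp_simple_path:
  assumes "r\<^sup>*\<^sup>* x y"
  shows "\<exists>p. p \<noteq> [] \<and> hd p = x \<and> last p = y \<and> distinct p \<and> successively r p \<and>
    (\<forall>w\<in>set p. r\<^sup>*\<^sup>* x w)"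
  using assms
proof (induction rule: converse_rtranclp_induct)
  case base
  show ?case by (rule exI[of _ "[y]"]) auto
next
  case (step x z)
  then obtain p where p: "p \<noteq> []" "hd p = z" "last p = y" "distinct p" "successively r p"
    and reach: "\<And>w. w \<in> set p \<Longrightarrow> r\<^sup>*\<^sup>* z w" by blast
  have reach': "r\<^sup>*\<^sup>* x w" if "w \<in> set p" for w
    using reach[OF that] step(1) by (rule converse_rtranclp_into_rtranclp[rotated])
  show ?case
  proof (cases "x \<in> set p")
    case True
    then obtain a b where "p = a @ x # b" by (auto simp: in_set_conv_decomp)
    then show ?thesis
      using p reach' by (intro exI[of _ "x # b"]) (auto simp: successively_append_iff)
  next
    case False
    then show ?thesis
      using p reach' step(1) by (intro exI[of _ "x # p"]) (auto simp: successively_Cons)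
  qed
qed

lemma degree_attach_pendants:
  assumes "finite_simple_graph T" and "v \<in> verts T"
  shows "degree (attach_pendants T v k) (Inl x) =
      (if x = v then degree T v + k else degree T x)"
    and "i < k \<Longrightarrow> degree (attach_pendants T v k) (Inr i) = 1"
proof -
  have Inl_edge: "{Inl x, Inl y} = (Inl ` e :: ('a + nat) set) \<longleftrightarrow> e = {x, y}" for x y e
  proof -
    have "{Inl x, Inl y} = (Inl ` {x, y} :: ('a + nat) set)" by simp
    then show ?thesis by (simp only: inj_image_eq_iff[OF inj_Inl]) auto
  qed
  have "{Inl x, Inr i} = (Inl ` e :: ('a + nat) set) \<longleftrightarrow> False" for x i and e :: "'a set"
    by (auto simp: set_eq_iff)
  moreover have "{Inr i, Inl x} = (Inl ` e :: ('a + nat) set) \<longleftrightarrow> False" for x i and e :: "'a set"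
    by (auto simp: set_eq_iff)
  moreover have "{Inr i, Inr j} = (Inl ` e :: ('a + nat) set) \<longleftrightarrow> False" for j i and e :: "'a set"
    by (auto simp: set_eq_iff)
  ultimately have adj: "adj (attach_pendants T v k) (Inl x) (Inl y) \<longleftrightarrow> adj T x y"
    "adj (attach_pendants T v k) (Inl x) (Inr i) \<longleftrightarrow> x = v \<and> i < k"
    "adj (attach_pendants T v k) (Inr i) (Inl x) \<longleftrightarrow> x = v \<and> i < k"
    "adj (attach_pendants T v k) (Inr i) (Inr j) \<longleftrightarrow> False" for x y i j
    by (auto simp: adj_def attach_pendants_def image_iff Inl_edge doubleton_eq_iff)
  have V: "Inl x \<in> verts (attach_pendants T v k) \<longleftrightarrow> x \<in> verts T"
    "Inr i \<in> verts (attach_pendants T v k) \<longleftrightarrow> i < k" for x i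
    by (auto simp: attach_pendants_def)
  have fin: "finite (neighbors T x)" for x
    using assms by (simp add: neighbors_def finite_simple_graph_def)
  have N: "neighbors (attach_pendants T v k) (Inl x) =
      Inl ` neighbors T x \<union> (if x = v then Inr ` {..<k} else {})" for x
  proof (rule Set.set_eqI)
    show "w \<in> neighbors (attach_pendants T v k) (Inl x) \<longleftrightarrow>
        w \<in> Inl ` neighbors T x \<union> (if x = v then Inr ` {..<k} else {})" for w
      by (cases w) (auto simp: neighbors_def adj V)
  qed
  have "card (Inl ` neighbors T x \<union> Inr ` {..<k} :: ('a + nat) set) = degree T x + k" for x
    using fin by (subst card_Un_disjoint) (auto simp: card_image degree_def)
  then show "degree (attach_pendants T v k) (Inl x) = (if x = v then degree T v + k else degree T x)"
    by (simp add: degree_def[of "attach_pendants T v k"] N card_image) (simp add: degree_def)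
  assume "i < k"
  have "neighbors (attach_pendants T v k) (Inr i) = {Inl v}"
  proof (rule Set.set_eqI)
    show "w \<in> neighbors (attach_pendants T v k) (Inr i) \<longleftrightarrow> w \<in> {Inl v}" for w
      using \<open>i < k\<close> assms(2) by (cases w) (auto simp: neighbors_def adj V)
  qed
  then show "degree (attach_pendants T v k) (Inr i) = 1" by (simp add: degree_def)
qed

text \<open>The Ricci matrix with \<open>1 / d\<^sub>v\<close> replaced by \<open>0\<close>: the direct sum of the branch matrices,
  described without reference to the branches.\<close>

definition reduced_entry :: "'a ugraph \<Rightarrow> 'a \<Rightarrow> 'a set \<Rightarrow> 'a set \<Rightarrow> real" where
  "reduced_entry T v e e' =
     (if v \<in> e \<and> v \<in> e'
      then (if e = e' then - (1 / real (degree T (the_elem (e - {v})))) else 0)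
      else ricci_entry T e e')"

lemma ricci_entry_commute: "ricci_entry T e e' = ricci_entry T e' e"
  by (simp add: ricci_entry_def Int_commute)

lemma reduced_entry_commute: "reduced_entry T v e e' = reduced_entry T v e' e"
  by (auto simp: reduced_entry_def ricci_entry_commute)

section \<open>The branches of a rooted tree\<close>

locale rooted_tree =
  fixes T :: "'a ugraph" and v :: 'a
  assumes tree: "finite_tree T" and root: "v \<in> verts T"
begin

abbreviation (input) reach :: "'a \<Rightarrow> 'a \<Rightarrow> bool" where
  "reach \<equiv> (adj (del_vert T v))\<^sup>*\<^sup>*"

lemma simple_graph: "finite_simple_graph T"
  using tree by (simp add: finite_tree_def)

lemma edgeE:
  assumes "e \<in> edges T"
  obtains x y where "x \<in> verts T" "y \<in> verts T" "x \<noteq> y" "e = {x, y}"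
  using simple_graph assms unfolding finite_simple_graph_def by blast

lemma edge_at_rootE:
  assumes "e \<in> edges T" and "v \<in> e"
  obtains u where "u \<in> neighbors T v" "u \<noteq> v" "e = {v, u}"
proof -
  obtain x y where xy: "x \<in> verts T" "y \<in> verts T" "x \<noteq> y" "e = {x, y}"
    using edgeE[OF assms(1)] .
  show thesis
  proof (cases "x = v")
    case True
    then show ?thesis using that[of y] xy assms(1) by (auto simp: neighbors_def adj_def)
  next
    case False
    then have e: "e = {v, x}" using xy assms(2) by auto
    then have "x \<in> neighbors T v" using xy(1) assms(1) by (simp add: neighbors_def adj_def)
    then show ?thesis using that False e by blast
  qed
qed

lemma finite_edges: "finite (edges T)"
proof (rule finite_subset)
  show "edges T \<subseteq> Pow (verts T)" using edgeE by blast
  show "finite (Pow (verts T))" using simple_graph by (simp add: finite_simple_graph_def)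
qed

lemma root_edge: "u \<in> neighbors T v \<Longrightarrow> {v, u} \<in> edges T"
  by (simp add: neighbors_def adj_def)

lemma neighbor_ne_root: "u \<in> neighbors T v \<Longrightarrow> u \<noteq> v"
  by (rule edgeE[OF root_edge]) (auto simp: doubleton_eq_iff)

lemma finite_neighbors: "finite (neighbors T v)"
  using simple_graph by (simp add: neighbors_def finite_simple_graph_def)

lemma adj_del: "adj (del_vert T v) x y \<longleftrightarrow> {x, y} \<in> edges T \<and> x \<noteq> v \<and> y \<noteq> v"
  by (auto simp: adj_def del_vert_def)

lemma reach_sym: "reach x y \<Longrightarrow> reach y x"
  by (rule sympD[OF symp_rtranclp]) (auto simp: symp_def adj_del insert_commute)

lemma reach_ne_root: "reach x y \<Longrightarrow> x \<noteq> v \<Longrightarrow> y \<noteq> v"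
  by (induction rule: rtranclp_induct) (auto simp: adj_del)

text \<open>A path in \<open>T - v\<close> between two distinct neighbours of \<open>v\<close> would close up through \<open>v\<close>.\<close>

lemma reach_neighbors_unique:
  assumes u: "u \<in> neighbors T v" and u': "u' \<in> neighbors T v" and r: "reach u u'"
  shows "u = u'"
proof (rule ccontr)
  assume ne: "u \<noteq> u'"
  obtain p where p: "p \<noteq> []" "hd p = u" "last p = u'" "distinct p"
      "successively (adj (del_vert T v)) p"
    and reach: "\<And>w. w \<in> set p \<Longrightarrow> reach u w"
    using rtranclp_simple_path[OF r] by blast
  have "v \<notin> set p"
    using reach reach_ne_root neighbor_ne_root[OF u] by blast
  \<comment> \<open>A cycle has at least three vertices: two come from \<open>p\<close>, as its ends
    differ, and v is the third.\<close>
  moreover have "successively (adj T) p"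
    using p(5) by (rule successively_mono) (auto simp: del_vert_def adj_def)
  moreover have "length p \<ge> 2"
    using p(1-3) ne by (cases p; cases "tl p") auto
  moreover have "adj T v u" "adj T u' v"
    using root_edge[OF u] root_edge[OF u'] by (auto simp: adj_def insert_commute)
  ultimately have "cycle T (v # p)"
    using p(1-4) by (auto simp: cycle_def successively_Cons)
  then show False using tree by (auto simp: finite_tree_def)
qed

text \<open>On a walk in T from x to v, the vertex just before the first visit to v is the desired
  neighbour. The induction peels the walk at its front: either the next vertex is v and x itself
  serves, or the neighbour found for the next vertex serves.\<close>

lemma reach_from_neighbor:
  assumes "x \<in> verts T" and "x \<noteq> v"
  shows "\<exists>u\<in>neighbors T v. reach u x"
proof -
  have "component T x = verts T"
    using tree assms(1) by (auto simp: finite_tree_def connected_graph_def)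
  then have "(adj T)\<^sup>*\<^sup>* x v" using root by (auto simp: component_def)
  then show ?thesis using assms(2)
  proof (induction rule: converse_rtranclp_induct)
    case (step x y)
    then have xy: "{x, y} \<in> edges T" by (simp add: adj_def)
    show ?case
    proof (cases "y = v")
      case True
      have "x \<in> verts T" using xy by (rule edgeE) (auto simp: doubleton_eq_iff)
      then have "x \<in> neighbors T v"
        using xy True by (simp add: neighbors_def adj_def insert_commute)
      then show ?thesis by blast
    next
      case False
      then obtain u where u: "u \<in> neighbors T v" "reach u y" using step by blast
      have "adj (del_vert T v) y x"
        using xy False step by (simp add: adj_del insert_commute)
      then show ?thesis using u by (meson rtranclp.rtrancl_into_rtrancl)
    qed
  qed simp
qed

lemma branch_edges_subset: "u \<in> neighbors T v \<Longrightarrow> branch_edges T v u \<subseteq> edges T"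
  using root_edge by (auto simp: branch_edges_def del_vert_def)

lemma branch_edges_at_root:
  "e \<in> branch_edges T v u \<Longrightarrow> v \<in> e \<Longrightarrow> e = {v, u}"
  by (auto simp: branch_edges_def del_vert_def)

lemma branch_edges_reach:
  "e \<in> branch_edges T v u \<Longrightarrow> z \<in> e \<Longrightarrow> z \<noteq> v \<Longrightarrow> reach u z"
  by (auto simp: branch_edges_def component_def)

text \<open>Both neighbours are joined to \<open>z\<close> inside T - v, hence to each other, which
  \<open>reach_neighbors_unique\<close> allows only if they coincide.\<close>

lemma branch_unique_of_common_vertex:
  assumes "u \<in> neighbors T v" "u' \<in> neighbors T v"
    and "e \<in> branch_edges T v u" "e' \<in> branch_edges T v u'"
    and "z \<in> e" "z \<in> e'" "z \<noteq> v"
  shows "u = u'"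
  using assms branch_edges_reach reach_sym reach_neighbors_unique by (meson rtranclp_trans)

lemma edge_other_vertex: "e \<in> edges T \<Longrightarrow> \<exists>z\<in>e. z \<noteq> v"
  by (erule edgeE) auto

lemma branch_unique:
  assumes "u \<in> neighbors T v" "u' \<in> neighbors T v"
    and "e \<in> branch_edges T v u" "e \<in> branch_edges T v u'"
  shows "u = u'"
  using edge_other_vertex[of e] branch_edges_subset assms branch_unique_of_common_vertex by blast

text \<open>An edge at v is a root edge. Any other edge survives in T - v, so the neighbour that
  reaches one of its ends reaches the other as well.\<close>

lemma branch_cover:
  assumes "e \<in> edges T"
  shows "\<exists>u\<in>neighbors T v. e \<in> branch_edges T v u"
proof (cases "v \<in> e")
  case True
  then obtain u where "u \<in> neighbors T v" "e = {v, u}" using edge_at_rootE assms by metis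
  then show ?thesis by (auto simp: branch_edges_def)
next
  case False
  obtain x y where xy: "x \<in> verts T" "y \<in> verts T" "e = {x, y}"
    using edgeE[OF assms] .
  then obtain u where u: "u \<in> neighbors T v" "reach u x"
    using reach_from_neighbor[of x] False by auto
  have "adj (del_vert T v) x y" using xy assms False by (auto simp: adj_del)
  then have "reach u y" using u(2) by (rule rtranclp.rtrancl_into_rtrancl[rotated])
  then have "e \<in> branch_edges T v u"
    using u xy False assms unfolding branch_edges_def component_def by (auto simp: del_vert_def)
  then show ?thesis using u(1) by blast
qed

text \<open>The root edge is the only edge of its branch that contains v, so within one branch the
  exceptional case of either definition is the same diagonal entry.\<close>

lemma branch_entry_eq_reduced_entry:
  assumes u: "u \<in> neighbors T v" and e: "e \<in> branch_edges T v u" "e' \<in> branch_edges T v u"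
  shows "branch_entry T v u e e' = reduced_entry T v e e'"
proof (cases "v \<in> e \<and> v \<in> e'")
  case True
  then have "e = {v, u}" "e' = {v, u}" using e branch_edges_at_root by blast+
  moreover have "{v, u} - {v} = {u}" using neighbor_ne_root[OF u] by auto
  ultimately show ?thesis by (simp add: branch_entry_def reduced_entry_def)
qed (auto simp: branch_entry_def reduced_entry_def)

text \<open>Edges of different branches can meet only in v, and there the entry 1/d(v) has been
  replaced by 0.\<close>

lemma reduced_entry_distinct_branches:
  assumes u: "u \<in> neighbors T v" "u' \<in> neighbors T v" "u \<noteq> u'"
    and e: "e \<in> branch_edges T v u" "e' \<in> branch_edges T v u'"
  shows "reduced_entry T v e e' = 0"
proof -
  have ne: "e \<noteq> e'" using branch_unique u e by blast
  have "e \<inter> e' = {}" if "\<not> (v \<in> e \<and> v \<in> e')"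
    using that branch_unique_of_common_vertex[OF u(1,2) e] u(3) by blast
  then show ?thesis using ne by (auto simp: reduced_entry_def ricci_entry_def)
qed

text \<open>Uniqueness of the branch of an edge evaluates the \<open>THE\<close> in
  \<open>limit_entry\<close>. From here on the limit matrix is handled without naming
  branches.\<close>

lemma limit_entry_edges:
  assumes "e \<in> edges T" "e' \<in> edges T"
  shows "limit_entry T v (Some e) (Some e') = reduced_entry T v e e'"
proof -
  obtain u where u: "u \<in> neighbors T v" "e \<in> branch_edges T v u"
    using branch_cover assms(1) by blast
  obtain u' where u': "u' \<in> neighbors T v" "e' \<in> branch_edges T v u'"
    using branch_cover assms(2) by blast
  show ?thesis
  proof (cases "u = u'")
    case True
    have "(THE w. w \<in> neighbors T v \<and> e \<in> branch_edges T v w \<and> e' \<in> branch_edges T v w) = u"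
      using u u' True branch_unique by (intro the_equality) blast+
    moreover have "\<exists>u\<in>neighbors T v. e \<in> branch_edges T v u \<and> e' \<in> branch_edges T v u"
      using u u' True by blast
    ultimately show ?thesis
      using branch_entry_eq_reduced_entry u u' True by simp
  next
    case False
    then have "\<not> (\<exists>u\<in>neighbors T v. e \<in> branch_edges T v u \<and> e' \<in> branch_edges T v u)"
      using u u' branch_unique by blast
    moreover have "reduced_entry T v e e' = 0"
      using reduced_entry_distinct_branches[of u u' e e'] u u' False by blast
    ultimately show ?thesis by (simp only: limit_entry.simps if_False)
  qed
qed

section \<open>Ricci entries and quadratic form after attaching pendant edges\<close>

lemma distinct_edges_Int:
  assumes "e \<in> edges T" "e' \<in> edges T" "e \<noteq> e'" "z \<in> e" "z \<in> e'"
  shows "e \<inter> e' = {z}"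
  using assms by (elim edgeE) auto

text \<open>Among the old vertices only v changes its degree. The coefficient of 1/n is 1 for two
  distinct edges at v and -1 = 1 - 2 on the diagonal; written this way it is a rank-one matrix,
  which later yields a square, minus a diagonal one.\<close>

lemma ricci_entry_attach_old:
  assumes e: "e \<in> edges T" "e' \<in> edges T"
  shows "ricci_entry (attach_pendants T v k) (Inl ` e) (Inl ` e') = reduced_entry T v e e' +
    (of_bool (v \<in> e) * of_bool (v \<in> e') - 2 * of_bool (e = e') * of_bool (v \<in> e)) /
      real (degree T v + k)"
proof -
  note deg = degree_attach_pendants(1)[OF simple_graph root]
  have inj: "(Inl ` e :: ('a + nat) set) = Inl ` e' \<longleftrightarrow> e = e'"
    by (rule inj_image_eq_iff) simp
  have Int: "(Inl ` e :: ('a + nat) set) \<inter> Inl ` e' = Inl ` (e \<inter> e')" by auto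
  show ?thesis
  proof (cases "e = e'")
    case True
    have sum: "(\<Sum>x\<in>Inl ` e. 1 / real (degree (attach_pendants T v k) x)) =
        (\<Sum>x\<in>e. 1 / real (if x = v then degree T v + k else degree T x))"
      by (subst sum.reindex) (auto simp: deg intro: inj_onI)
    show ?thesis
    proof (cases "v \<in> e")
      case v: True
      then obtain u where u: "u \<noteq> v" "e = {v, u}" using edge_at_rootE e(1) by metis
      then have "e - {v} = {u}" by auto
      then show ?thesis
        using u True v sum by (simp add: ricci_entry_def reduced_entry_def diff_divide_distrib)
    next
      case False
      then have "(\<Sum>x\<in>e. 1 / real (if x = v then degree T v + k else degree T x)) =
          (\<Sum>x\<in>e. 1 / real (degree T x))"
        by (intro sum.cong) auto
      then show ?thesis
        using True False sum by (simp add: ricci_entry_def reduced_entry_def)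
    qed
  next
    case ne: False
    show ?thesis
    proof (cases "e \<inter> e' = {}")
      case True
      then have "\<not> (v \<in> e \<and> v \<in> e')" by auto
      then show ?thesis
        using True ne by (auto simp: ricci_entry_def reduced_entry_def inj Int)
    next
      case False
      then obtain z where z: "z \<in> e" "z \<in> e'" by auto
      then have I: "e \<inter> e' = {z}" using distinct_edges_Int e ne by blast
      then have "v \<in> e \<and> v \<in> e' \<longleftrightarrow> v = z" by auto
      then show ?thesis
        using I ne by (auto simp: ricci_entry_def reduced_entry_def inj Int deg)
    qed
  qed
qed

lemma ricci_entry_attach_mixed:
  assumes "e \<in> edges T"
  shows "ricci_entry (attach_pendants T v k) (Inl ` e) {Inl v, Inr i} =
    of_bool (v \<in> e) / real (degree T v + k)"
proof -
  have "Inl ` e \<noteq> {Inl v, Inr i}" by (auto simp: set_eq_iff)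
  moreover have "Inl ` e \<inter> {Inl v, Inr i} = (if v \<in> e then {Inl v} else {})" by auto
  ultimately show ?thesis
    by (simp add: ricci_entry_def degree_attach_pendants[OF simple_graph root])
qed

text \<open>The diagonal entry -(1/n + 1) is split as 1/n - (1 + 2/n), so that the constant 1/n
  fills the whole block and again has rank one.\<close>

lemma ricci_entry_attach_new:
  assumes "i < k"
  shows "ricci_entry (attach_pendants T v k) {Inl v, Inr i} {Inl v, Inr j} =
    1 / real (degree T v + k) - of_bool (i = j) * (1 + 2 / real (degree T v + k))"
proof (cases "i = j")
  case True
  then show ?thesis
    using assms by (simp add: ricci_entry_def degree_attach_pendants[OF simple_graph root] add_divide_distrib)
next
  case False
  then have "{Inl v, Inr i} \<inter> {Inl v, Inr j} = {Inl v}" by auto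
  then show ?thesis
    using False by (simp add: ricci_entry_def degree_attach_pendants[OF simple_graph root] doubleton_eq_iff)
qed

lemma sum_edges_attach:
  fixes f :: "('a + nat) set \<Rightarrow> 'b :: comm_monoid_add"
  shows "(\<Sum>e\<in>edges (attach_pendants T v k). f e) =
    (\<Sum>e\<in>edges T. f (Inl ` e)) + (\<Sum>i<k. f {Inl v, Inr i})"
proof -
  have "(Inl ` e :: ('a + nat) set) \<noteq> {Inl v, Inr i}" for e i by (auto simp: set_eq_iff)
  then have "(\<lambda>e. Inl ` e) ` edges T \<inter> (\<lambda>i. {Inl v, Inr i}) ` {..<k} = {}" by auto
  then have "(\<Sum>e\<in>edges (attach_pendants T v k). f e) =
      (\<Sum>e\<in>(\<lambda>e. Inl ` e) ` edges T. f e) + (\<Sum>e\<in>(\<lambda>i. {Inl v, Inr i}) ` {..<k}. f e)"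
    using finite_edges by (simp add: attach_pendants_def sum.union_disjoint)
  moreover have "inj_on (\<lambda>e. Inl ` e :: ('a + nat) set) (edges T)"
    by (rule inj_onI) (simp add: inj_image_eq_iff)
  moreover have "inj_on (\<lambda>i. {Inl v, Inr i} :: ('a + nat) set) {..<k}"
    by (rule inj_onI) (auto simp: doubleton_eq_iff)
  ultimately show ?thesis by (simp add: sum.reindex)
qed

text \<open>The rank-one parts of the old block, the two mixed blocks and the new block contribute
  s^2, 2 s G and G^2, which combine to (s + G)^2 / n. What remains is the reduced form and the
  diagonal corrections.\<close>

lemma quadratic_form_attach:
  fixes x :: "('a + nat) set \<Rightarrow> real" and k :: nat
  defines "f \<equiv> \<lambda>e. x (Inl ` e)" and "g \<equiv> \<lambda>i. x {Inl v, Inr i}" and "n \<equiv> real (degree T v + k)"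
  shows "(\<Sum>e\<in>edges (attach_pendants T v k). \<Sum>e'\<in>edges (attach_pendants T v k).
      ricci_entry (attach_pendants T v k) e e' * x e * x e') =
    (\<Sum>e\<in>edges T. \<Sum>e'\<in>edges T. reduced_entry T v e e' * f e * f e')
    + (((\<Sum>e\<in>edges T. of_bool (v \<in> e) * f e) + (\<Sum>i<k. g i))\<^sup>2
       - 2 * (\<Sum>e\<in>edges T. of_bool (v \<in> e) * (f e)\<^sup>2)) / n
    - (1 + 2 / n) * (\<Sum>i<k. (g i)\<^sup>2)"
proof -
  let ?E = "edges T" and ?R = "ricci_entry (attach_pendants T v k)"
  define s where "s = (\<Sum>e\<in>?E. of_bool (v \<in> e) * f e)"
  define G where "G = (\<Sum>i<k. g i)"
  have "(\<Sum>e\<in>?E. \<Sum>e'\<in>?E. ?R (Inl ` e) (Inl ` e') * f e * f e') =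
      (\<Sum>e\<in>?E. \<Sum>e'\<in>?E. reduced_entry T v e e' * f e * f e'
        + (of_bool (v \<in> e) * f e) * (of_bool (v \<in> e') * f e') / n
        - 2 / n * (of_bool (e = e') * (of_bool (v \<in> e) * f e * f e')))"
  proof (intro sum.cong refl)
    have "(r + (a * b - 2 * c * a) / n) * y * z =
        r * y * z + (a * y) * (b * z) / n - 2 / n * (c * (a * y * z))" for r a b c y z :: real
      by (simp add: diff_divide_distrib algebra_simps)
    then show "?R (Inl ` e) (Inl ` e') * f e * f e' = reduced_entry T v e e' * f e * f e'
        + (of_bool (v \<in> e) * f e) * (of_bool (v \<in> e') * f e') / n
        - 2 / n * (of_bool (e = e') * (of_bool (v \<in> e) * f e * f e'))"
      if "e \<in> ?E" "e' \<in> ?E" for e e'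
      unfolding ricci_entry_attach_old[OF that] n_def .
  qed
  also have "\<dots> = (\<Sum>e\<in>?E. \<Sum>e'\<in>?E. reduced_entry T v e e' * f e * f e') + s * s / n
      - 2 / n * (\<Sum>e\<in>?E. of_bool (v \<in> e) * (f e)\<^sup>2)"
  proof -
    have "(\<Sum>e\<in>?E. \<Sum>e'\<in>?E. (of_bool (v \<in> e) * f e) * (of_bool (v \<in> e') * f e') / n) = s * s / n"
      by (simp only: s_def sum_product sum_divide_distrib)
    moreover have "(\<Sum>e'\<in>?E. of_bool (e = e') * (of_bool (v \<in> e) * f e * f e')) =
        of_bool (v \<in> e) * (f e)\<^sup>2" if "e \<in> ?E" for e
    proof -
      have "(\<Sum>e'\<in>?E. of_bool (e = e') * (of_bool (v \<in> e) * f e * f e')) =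
          (\<Sum>e'\<in>?E. if e = e' then of_bool (v \<in> e) * f e * f e' else 0)"
        by (intro sum.cong) auto
      then show ?thesis using that finite_edges by (simp add: power2_eq_square)
    qed
    ultimately show ?thesis
      by (simp add: sum.distrib sum_subtractf sum_distrib_left[symmetric]
          del: times_divide_eq_left times_divide_eq_right)
  qed
  finally have old: "(\<Sum>e\<in>?E. \<Sum>e'\<in>?E. ?R (Inl ` e) (Inl ` e') * f e * f e') = \<dots>" .
  have mixed: "(\<Sum>e\<in>?E. \<Sum>i<k. ?R (Inl ` e) {Inl v, Inr i} * f e * g i) = s * G / n"
    unfolding s_def G_def sum_product sum_divide_distrib
    by (intro sum.cong refl) (simp add: ricci_entry_attach_mixed n_def)
  have mixed': "(\<Sum>i<k. \<Sum>e\<in>?E. ?R {Inl v, Inr i} (Inl ` e) * g i * f e) = s * G / n"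
    unfolding mixed[symmetric] by (subst sum.swap) (simp add: ricci_entry_commute mult.assoc mult.commute[of "g _"])
  have "(\<Sum>i<k. \<Sum>j<k. ?R {Inl v, Inr i} {Inl v, Inr j} * g i * g j) =
      (\<Sum>i<k. \<Sum>j<k. g i * g j / n - (1 + 2 / n) * (of_bool (i = j) * (g i * g j)))"
    by (intro sum.cong refl) (simp add: ricci_entry_attach_new n_def algebra_simps)
  also have "\<dots> = G * G / n - (1 + 2 / n) * (\<Sum>i<k. (g i)\<^sup>2)"
  proof -
    have "(\<Sum>i<k. \<Sum>j<k. g i * g j / n) = G * G / n"
      by (simp only: G_def sum_product sum_divide_distrib)
    moreover have "(\<Sum>j<k. of_bool (i = j) * (g i * g j)) = (g i)\<^sup>2" if "i < k" for i
    proof -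
      have "(\<Sum>j<k. of_bool (i = j) * (g i * g j)) = (\<Sum>j<k. if i = j then g i * g j else 0)"
        by (intro sum.cong) auto
      then show ?thesis using that by (simp add: power2_eq_square)
    qed
    ultimately show ?thesis
      by (simp add: sum_subtractf sum_distrib_left[symmetric])
  qed
  finally have new: "(\<Sum>i<k. \<Sum>j<k. ?R {Inl v, Inr i} {Inl v, Inr j} * g i * g j) = \<dots>" .
  have "(\<Sum>e\<in>edges (attach_pendants T v k). \<Sum>e'\<in>edges (attach_pendants T v k). ?R e e' * x e * x e') =
      (\<Sum>e\<in>?E. \<Sum>e'\<in>?E. ?R (Inl ` e) (Inl ` e') * f e * f e') +
      (\<Sum>e\<in>?E. \<Sum>i<k. ?R (Inl ` e) {Inl v, Inr i} * f e * g i) +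
      ((\<Sum>i<k. \<Sum>e\<in>?E. ?R {Inl v, Inr i} (Inl ` e) * g i * f e) +
      (\<Sum>i<k. \<Sum>j<k. ?R {Inl v, Inr i} {Inl v, Inr j} * g i * g j))"
    by (simp add: sum_edges_attach sum.distrib f_def g_def)
  then show ?thesis
    unfolding old mixed mixed' new s_def[symmetric] G_def[symmetric]
    by (simp add: power2_eq_square add_divide_distrib diff_divide_distrib distrib_left distrib_right mult.commute)
qed

section \<open>The limit of the largest eigenvalue\<close>

lemma sum_insert_None:
  fixes f :: "'a set option \<Rightarrow> 'b :: comm_monoid_add"
  shows "(\<Sum>i\<in>insert None (Some ` edges T). f i) = f None + (\<Sum>e\<in>edges T. f (Some e))"
  using finite_edges by (simp add: sum.reindex image_iff)

lemma finite_limit_index: "finite (insert None (Some ` edges T))"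
  using finite_edges by simp

lemma eigenvalue_limit_zero: "eigenvalue (limit_matrix T v) 0"
  unfolding limit_matrix_def by (rule zero_row_eigenvalue[OF finite_limit_index, of None]) auto

text \<open>Extending the eigenvector by 0 at the extra index hides the column of that index, and
  the row of that index is zero.\<close>

lemma eigenvalue_limit_of_reduced:
  assumes "eigenvalue (matrix_on (edges T) (reduced_entry T v)) c"
  shows "eigenvalue (limit_matrix T v) c"
proof -
  obtain x where nz: "\<exists>e\<in>edges T. x e \<noteq> 0"
    and x: "\<And>e. e \<in> edges T \<Longrightarrow> (\<Sum>e'\<in>edges T. reduced_entry T v e e' * x e') = c * x e"
    using assms unfolding eigenvalue_matrix_on_iff[OF finite_edges] by blast
  define y where "y i = (case i of None \<Rightarrow> 0 | Some e \<Rightarrow> x e)" for i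
  have "\<exists>i\<in>insert None (Some ` edges T). y i \<noteq> 0"
    using nz by (auto simp: y_def)
  moreover have "(\<Sum>j\<in>insert None (Some ` edges T). limit_entry T v i j * y j) = c * y i"
    if "i \<in> insert None (Some ` edges T)" for i
  proof (cases i)
    case None
    then show ?thesis by (simp add: y_def)
  next
    case (Some e)
    then have e: "e \<in> edges T" using that by auto
    have "(\<Sum>e'\<in>edges T. limit_entry T v (Some e) (Some e') * x e') =
        (\<Sum>e'\<in>edges T. reduced_entry T v e e' * x e')"
      using e by (intro sum.cong refl) (simp only: limit_entry_edges)
    then show ?thesis
      using x[OF e] by (simp only: sum_insert_None) (simp add: y_def Some del: limit_entry.simps)
  qed
  ultimately show ?thesis
    unfolding limit_matrix_def eigenvalue_matrix_on_iff[OF finite_limit_index] by blast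
qed

lemma eigenvalue_reduced_of_limit:
  assumes "eigenvalue (limit_matrix T v) c" and c: "c \<noteq> 0"
  shows "eigenvalue (matrix_on (edges T) (reduced_entry T v)) c"
proof -
  obtain x where nz: "\<exists>i\<in>insert None (Some ` edges T). x i \<noteq> 0"
    and x: "\<And>i. i \<in> insert None (Some ` edges T) \<Longrightarrow>
      (\<Sum>j\<in>insert None (Some ` edges T). limit_entry T v i j * x j) = c * x i"
    using assms(1) unfolding limit_matrix_def eigenvalue_matrix_on_iff[OF finite_limit_index] by blast
  \<comment> \<open>The zero row reads 0 = c * x None; with c nonzero the entry vanishes, and the
    column of the extra index drops out of all other rows.\<close>
  have x0: "x None = 0" using x[of None] c by simp
  have "(\<Sum>e'\<in>edges T. reduced_entry T v e e' * x (Some e')) = c * x (Some e)" if e: "e \<in> edges T" for e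
  proof -
    have "(\<Sum>e'\<in>edges T. reduced_entry T v e e' * x (Some e')) =
        (\<Sum>e'\<in>edges T. limit_entry T v (Some e) (Some e') * x (Some e'))"
      using e by (intro sum.cong refl) (simp only: limit_entry_edges)
    also have "\<dots> = c * x (Some e)"
      using x[of "Some e"] e x0 unfolding sum_insert_None by simp
    finally show ?thesis .
  qed
  moreover have "\<exists>e\<in>edges T. x (Some e) \<noteq> 0" using nz x0 by auto
  ultimately show ?thesis
    unfolding eigenvalue_matrix_on_iff[OF finite_edges] by (intro exI[of _ "\<lambda>e. x (Some e)"]) blast
qed

text \<open>The limit matrix is not symmetric, so this is what makes its \<open>lambda_max\<close> a
  largest eigenvalue in the intended sense. An eigenvector for a nonzero complex eigenvalue vanishes
  at the extra index and restricts to the symmetric reduced matrix.\<close>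

lemma real_spectrum_limit: "real_spectrum (limit_matrix T v)"
  unfolding real_spectrum_def
proof
  fix c assume "c \<in> spectrum (map_mat complex_of_real (limit_matrix T v))"
  then have "eigenvalue (map_mat complex_of_real
      (matrix_on (insert None (Some ` edges T)) (limit_entry T v))) c"
    by (simp add: spectrum_def limit_matrix_def)
  then obtain x where nz: "\<exists>i\<in>insert None (Some ` edges T). x i \<noteq> 0"
    and x: "\<And>i. i \<in> insert None (Some ` edges T) \<Longrightarrow>
      (\<Sum>j\<in>insert None (Some ` edges T). of_real (limit_entry T v i j) * x j) = c * x i"
    using complex_eigenvalue_matrix_on[OF finite_limit_index] by blast
  show "c \<in> \<real>"
  proof (cases "c = 0")
    case False
    then have x0: "x None = 0" using x[of None] by simp
    have "(\<Sum>e'\<in>edges T. of_real (reduced_entry T v e e') * x (Some e')) = c * x (Some e)"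
      if e: "e \<in> edges T" for e
    proof -
      have "(\<Sum>e'\<in>edges T. of_real (reduced_entry T v e e') * x (Some e')) =
          (\<Sum>e'\<in>edges T. of_real (limit_entry T v (Some e) (Some e')) * x (Some e'))"
        using e by (intro sum.cong refl) (simp only: limit_entry_edges)
      also have "\<dots> = c * x (Some e)"
        using x[of "Some e"] e x0 unfolding sum_insert_None by simp
      finally show ?thesis .
    qed
    moreover have "\<exists>e\<in>edges T. x (Some e) \<noteq> 0" using nz x0 by auto
    ultimately show ?thesis
      by (intro symmetric_eigenvalue_real[OF finite_edges reduced_entry_commute])
  qed simp
qed

lemma sum_reduced_entry_branch:
  assumes u: "u \<in> neighbors T v" and e: "e \<in> branch_edges T v u"
  shows "(\<Sum>e'\<in>edges T. reduced_entry T v e e' * x e') =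
    (\<Sum>e'\<in>branch_edges T v u. branch_entry T v u e e' * x e')"
proof -
  have "reduced_entry T v e e' = 0" if "e' \<in> edges T - branch_edges T v u" for e'
    using branch_cover[of e'] that reduced_entry_distinct_branches[OF u] e by (metis Diff_iff)
  then have "(\<Sum>e'\<in>edges T. reduced_entry T v e e' * x e') =
      (\<Sum>e'\<in>branch_edges T v u. reduced_entry T v e e' * x e')"
    using branch_edges_subset[OF u] finite_edges by (intro sum.mono_neutral_right) auto
  also have "\<dots> = (\<Sum>e'\<in>branch_edges T v u. branch_entry T v u e e' * x e')"
    using branch_entry_eq_reduced_entry[OF u e] by (intro sum.cong) auto
  finally show ?thesis .
qed

lemma finite_branch_edges: "u \<in> neighbors T v \<Longrightarrow> finite (branch_edges T v u)"
  using branch_edges_subset finite_edges finite_subset by blast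

text \<open>The reduced matrix is block diagonal over the branches. An eigenvector restricts to a
  branch on which it is nonzero; conversely, an eigenvector of one branch is extended by 0.\<close>

lemma eigenvalue_reduced_iff_branch:
  "eigenvalue (matrix_on (edges T) (reduced_entry T v)) c \<longleftrightarrow>
    (\<exists>u\<in>neighbors T v. eigenvalue (branch_matrix T v u) c)"
proof
  assume "eigenvalue (matrix_on (edges T) (reduced_entry T v)) c"
  then obtain x e0 where e0: "e0 \<in> edges T" "x e0 \<noteq> 0"
    and x: "\<And>e. e \<in> edges T \<Longrightarrow> (\<Sum>e'\<in>edges T. reduced_entry T v e e' * x e') = c * x e"
    unfolding eigenvalue_matrix_on_iff[OF finite_edges] by blast
  obtain u where u: "u \<in> neighbors T v" "e0 \<in> branch_edges T v u"
    using branch_cover[OF e0(1)] by blast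
  have "(\<Sum>e'\<in>branch_edges T v u. branch_entry T v u e e' * x e') = c * x e"
    if "e \<in> branch_edges T v u" for e
    using sum_reduced_entry_branch[OF u(1) that, of x] x[of e] branch_edges_subset[OF u(1)] that by auto
  then have "eigenvalue (branch_matrix T v u) c"
    unfolding branch_matrix_def eigenvalue_matrix_on_iff[OF finite_branch_edges[OF u(1)]]
    using u(2) e0(2) by blast
  then show "\<exists>u\<in>neighbors T v. eigenvalue (branch_matrix T v u) c" using u(1) by blast
next
  assume "\<exists>u\<in>neighbors T v. eigenvalue (branch_matrix T v u) c"
  then obtain u where u: "u \<in> neighbors T v" and "eigenvalue (branch_matrix T v u) c" by blast
  then obtain x where nz: "\<exists>e\<in>branch_edges T v u. x e \<noteq> 0"
    and x: "\<And>e. e \<in> branch_edges T v u \<Longrightarrow>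
      (\<Sum>e'\<in>branch_edges T v u. branch_entry T v u e e' * x e') = c * x e"
    unfolding branch_matrix_def eigenvalue_matrix_on_iff[OF finite_branch_edges[OF u]] by blast
  define y where "y e = (if e \<in> branch_edges T v u then x e else 0)" for e
  have "(\<Sum>e'\<in>edges T. reduced_entry T v e e' * y e') = c * y e" if e: "e \<in> edges T" for e
  proof -
    obtain w where w: "w \<in> neighbors T v" "e \<in> branch_edges T v w"
      using branch_cover[OF e] by blast
    note sum = sum_reduced_entry_branch[OF w, of y]
    show ?thesis
    proof (cases "w = u")
      case True
      have "(\<Sum>e'\<in>branch_edges T v u. branch_entry T v u e e' * y e') =
          (\<Sum>e'\<in>branch_edges T v u. branch_entry T v u e e' * x e')"
        by (intro sum.cong) (auto simp: y_def)
      then show ?thesis using sum x w True by (simp add: y_def)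
    next
      case False
      then have "y e' = 0" if "e' \<in> branch_edges T v w" for e'
        using branch_unique[OF w(1) u that] by (auto simp: y_def)
      then show ?thesis using sum w(2) by simp
    qed
  qed
  moreover have "\<exists>e\<in>edges T. y e \<noteq> 0"
    using nz branch_edges_subset[OF u] by (auto simp: y_def)
  ultimately show "eigenvalue (matrix_on (edges T) (reduced_entry T v)) c"
    unfolding eigenvalue_matrix_on_iff[OF finite_edges] by blast
qed

lemma branch_entry_commute: "branch_entry T v u e e' = branch_entry T v u e' e"
  by (auto simp: branch_entry_def ricci_entry_commute)

lemma lambda_max_limit_cases:
  "lambda_max (limit_matrix T v) = 0 \<or>
   eigenvalue (matrix_on (edges T) (reduced_entry T v)) (lambda_max (limit_matrix T v))"
  using eigenvalue_reduced_of_limit eigenvalue_lambda_max[OF finite_limit_index] eigenvalue_limit_zero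
  unfolding limit_matrix_def by blast

lemma eigenvalue_le_lambda_max_limit:
  "eigenvalue (limit_matrix T v) c \<Longrightarrow> c \<le> lambda_max (limit_matrix T v)"
  unfolding limit_matrix_def by (rule eigenvalue_le_lambda_max[OF finite_limit_index])

lemma lambda_max_limit_nonneg: "0 \<le> lambda_max (limit_matrix T v)"
  by (rule eigenvalue_le_lambda_max_limit[OF eigenvalue_limit_zero])

lemma lambda_max_limit_eq_Max:
  "lambda_max (limit_matrix T v) =
    Max (insert 0 ((\<lambda>u. lambda_max (branch_matrix T v u)) ` neighbors T v))"
proof (rule antisym)
  have fin: "finite (insert 0 ((\<lambda>u. lambda_max (branch_matrix T v u)) ` neighbors T v))"
    using finite_neighbors by simp
  show "lambda_max (limit_matrix T v) \<le>
      Max (insert 0 ((\<lambda>u. lambda_max (branch_matrix T v u)) ` neighbors T v))"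
    using lambda_max_limit_cases
  proof
    assume "lambda_max (limit_matrix T v) = 0"
    then show ?thesis using fin by simp
  next
    assume "eigenvalue (matrix_on (edges T) (reduced_entry T v)) (lambda_max (limit_matrix T v))"
    then obtain u where u: "u \<in> neighbors T v"
      and "eigenvalue (branch_matrix T v u) (lambda_max (limit_matrix T v))"
      using eigenvalue_reduced_iff_branch by blast
    then have "lambda_max (limit_matrix T v) \<le> lambda_max (branch_matrix T v u)"
      unfolding branch_matrix_def by (intro eigenvalue_le_lambda_max finite_branch_edges)
    also have "\<dots> \<le> Max (insert 0 ((\<lambda>u. lambda_max (branch_matrix T v u)) ` neighbors T v))"
      using fin u by (intro Max_ge) auto
    finally show ?thesis .
  qed
  have "lambda_max (branch_matrix T v u) \<le> lambda_max (limit_matrix T v)" if u: "u \<in> neighbors T v" for u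
  proof -
    \<comment> \<open>A branch contains at least its root edge, so its symmetric matrix is nonempty
      and \<open>lambda_max\<close> really is an eigenvalue of it.\<close>
    have "eigenvalue (branch_matrix T v u) (lambda_max (branch_matrix T v u))"
      unfolding branch_matrix_def using finite_branch_edges[OF u]
      by (rule lambda_max_is_eigenvalue_of_symmetric)
        (auto simp: branch_edges_def intro: branch_entry_commute)
    then have "eigenvalue (limit_matrix T v) (lambda_max (branch_matrix T v u))"
      using u eigenvalue_reduced_iff_branch eigenvalue_limit_of_reduced by blast
    then show ?thesis by (rule eigenvalue_le_lambda_max_limit)
  qed
  then show "Max (insert 0 ((\<lambda>u. lambda_max (branch_matrix T v u)) ` neighbors T v)) \<le>
      lambda_max (limit_matrix T v)"
    using fin lambda_max_limit_nonneg by simp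
qed

section \<open>Lower and upper bounds for the largest eigenvalue, and the limit\<close>

lemma finite_edges_attach: "finite (edges (attach_pendants T v k))"
  using finite_edges by (simp add: attach_pendants_def)

text \<open>The constant d + 2 covers both cases of \<open>lambda_max_limit_cases\<close>: the
  pendant indicator loses exactly (d + 2)/n, an eigenvector of the reduced matrix at most
  2/n.\<close>

lemma lambda_max_attach_lower:
  assumes k: "k > 0"
  shows "lambda_max (limit_matrix T v) - (real (degree T v) + 2) / (real (degree T v) + real k) \<le>
    lambda_max (ricci_matrix (attach_pendants T v k))"
proof -
  let ?mu = "lambda_max (limit_matrix T v)" and ?lk = "lambda_max (ricci_matrix (attach_pendants T v k))"
  define n where "n = real (degree T v + k)"
  have n: "n > 0" using k by (simp add: n_def)
  have "edges (attach_pendants T v k) \<noteq> {}" using k by (auto simp: attach_pendants_def)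
  note rayleigh = quadratic_form_le_lambda_max[OF finite_edges_attach this,
      of "ricci_entry (attach_pendants T v k)", OF ricci_entry_commute]
  \<comment> \<open>One family of test vectors serves both cases: \<open>y\<close> on the old edges
    and the constant \<open>t\<close> on the pendant ones.\<close>
  have test: "(\<Sum>e\<in>edges T. \<Sum>e'\<in>edges T. reduced_entry T v e e' * y e * y e')
    + (((\<Sum>e\<in>edges T. of_bool (v \<in> e) * y e) + real k * t)\<^sup>2
       - 2 * (\<Sum>e\<in>edges T. of_bool (v \<in> e) * (y e)\<^sup>2)) / n
    - (1 + 2 / n) * (real k * t\<^sup>2) \<le> ?lk * ((\<Sum>e\<in>edges T. (y e)\<^sup>2) + real k * t\<^sup>2)" for y t
  proof -
    define x where "x e = (if \<exists>i::nat. Inr i \<in> e then t else y (Inl -` e))" for e :: "('a + nat) set"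
    have "x {Inl v, Inr i} = t" for i by (auto simp: x_def)
    moreover have "x (Inl ` e) = y e" for e by (auto simp: x_def inj_vimage_image_eq)
    ultimately show ?thesis
      using rayleigh[of x] unfolding quadratic_form_attach
      unfolding sum_edges_attach n_def ricci_matrix_def by simp
  qed
  show ?thesis
    using lambda_max_limit_cases
  proof
    assume mu: "?mu = 0"
    \<comment> \<open>Here \<open>y\<close> is 0 and \<open>t\<close> is 1, so the Rayleigh quotient
      is k/n - 1 - 2/n with n = d + k.\<close>
    have "(real k)\<^sup>2 / n - (1 + 2 / n) * real k \<le> ?lk * real k"
      using test[of "\<lambda>_. 0" 1] by simp
    then have "real k * (real k / n - (1 + 2 / n)) \<le> real k * ?lk"
      by (simp add: power2_eq_square algebra_simps)
    then have "real k / n - (1 + 2 / n) \<le> ?lk" using k by simp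
    moreover have "real k / n - (1 + 2 / n) = (real k - n - 2) / n"
      using n by (simp add: diff_divide_distrib)
    moreover have "real k - n - 2 = - (real (degree T v) + 2)"
      by (simp add: n_def)
    ultimately show ?thesis using mu by (simp add: n_def minus_divide_left)
  next
    assume "eigenvalue (matrix_on (edges T) (reduced_entry T v)) ?mu"
    then obtain y where nz: "\<exists>e\<in>edges T. y e \<noteq> 0"
      and y: "\<And>e. e \<in> edges T \<Longrightarrow> (\<Sum>e'\<in>edges T. reduced_entry T v e e' * y e') = ?mu * y e"
      unfolding eigenvalue_matrix_on_iff[OF finite_edges] by blast
    define F where "F = (\<Sum>e\<in>edges T. (y e)\<^sup>2)"
    have F: "F > 0"
      unfolding F_def using nz finite_edges by (metis (no_types, lifting) sum_pos2 zero_le_power2 zero_less_power2)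
    \<comment> \<open>With \<open>t\<close> = 0 the square is nonnegative and only the diagonal
      correction can lower the form, by at most 2 F / n.\<close>
    have "(\<Sum>e\<in>edges T. of_bool (v \<in> e) * (y e)\<^sup>2) \<le> F"
      unfolding F_def by (intro sum_mono) auto
    then have "((\<Sum>e\<in>edges T. of_bool (v \<in> e) * y e)\<^sup>2
        - 2 * (\<Sum>e\<in>edges T. of_bool (v \<in> e) * (y e)\<^sup>2)) / n \<ge> (- 2 * F) / n"
      using n zero_le_power2[of "\<Sum>e\<in>edges T. of_bool (v \<in> e) * y e"]
      by (intro divide_right_mono) linarith+
    moreover have "(\<Sum>e\<in>edges T. \<Sum>e'\<in>edges T. reduced_entry T v e e' * y e * y e') = ?mu * F"
      unfolding F_def by (rule quadratic_form_eigenvector[OF y])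
    ultimately have "(?mu - 2 / n) * F \<le> ?lk * F"
      using test[of y 0] by (simp add: F_def[symmetric] algebra_simps)
    then have "?mu - 2 / n \<le> ?lk" using F by simp
    moreover have "2 / n \<le> (real (degree T v) + 2) / n"
      using n by (intro divide_right_mono) auto
    ultimately show ?thesis by (simp add: n_def)
  qed
qed

text \<open>The form is evaluated at an eigenvector for the largest eigenvalue itself, so its value
  is that eigenvalue times F + H, and any bound by a multiple of F + H suffices. The free \<epsilon>
  weighs the error on the pendant edges against that on the old ones.\<close>

lemma lambda_max_attach_upper:
  assumes k: "k > 0" and ne: "edges T \<noteq> {}" and eps: "\<epsilon> > 0"
  shows "lambda_max (ricci_matrix (attach_pendants T v k)) \<le> lambda_max (limit_matrix T v) + \<epsilon> +
    (1 + 1 / \<epsilon>) * real (card (edges T)) / (real (degree T v) + real k)"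
proof -
  let ?mu = "lambda_max (limit_matrix T v)" and ?lk = "lambda_max (ricci_matrix (attach_pendants T v k))"
    and ?Ek = "edges (attach_pendants T v k)"
  define n where "n = real (degree T v + k)"
  have n: "n > 0" "real k \<le> n" using k by (simp_all add: n_def)
  have "?Ek \<noteq> {}" using k by (auto simp: attach_pendants_def)
  then have "eigenvalue (ricci_matrix (attach_pendants T v k)) ?lk"
    unfolding ricci_matrix_def
    by (intro lambda_max_is_eigenvalue_of_symmetric finite_edges_attach ricci_entry_commute)
  then obtain x where nz: "\<exists>e\<in>?Ek. x e \<noteq> 0"
    and x: "\<And>e. e \<in> ?Ek \<Longrightarrow> (\<Sum>e'\<in>?Ek. ricci_entry (attach_pendants T v k) e e' * x e') = ?lk * x e"
    unfolding ricci_matrix_def eigenvalue_matrix_on_iff[OF finite_edges_attach] by blast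
  define f where "f e = x (Inl ` e)" for e
  define g where "g i = x {Inl v, Inr i}" for i
  define F where "F = (\<Sum>e\<in>edges T. (f e)\<^sup>2)"
  define H where "H = (\<Sum>i<k. (g i)\<^sup>2)"
  define s where "s = (\<Sum>e\<in>edges T. of_bool (v \<in> e) * f e)"
  define G where "G = (\<Sum>i<k. g i)"
  define D where "D = real (card (edges T))"
  have FH: "F \<ge> 0" "H \<ge> 0" "D \<ge> 0" by (simp_all add: F_def H_def D_def sum_nonneg)
  have "(\<Sum>e\<in>?Ek. (x e)\<^sup>2) > 0"
    using nz finite_edges_attach by (metis (no_types, lifting) sum_pos2 zero_le_power2 zero_less_power2)
  then have pos: "F + H > 0"
    by (simp add: sum_edges_attach F_def H_def f_def g_def)
  have "?lk * (F + H) = (\<Sum>e\<in>?Ek. \<Sum>e'\<in>?Ek. ricci_entry (attach_pendants T v k) e e' * x e * x e')"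
    using quadratic_form_eigenvector[OF x] by (simp add: sum_edges_attach F_def H_def f_def g_def)
  also have "\<dots> = (\<Sum>e\<in>edges T. \<Sum>e'\<in>edges T. reduced_entry T v e e' * f e * f e')
    + ((s + G)\<^sup>2 - 2 * (\<Sum>e\<in>edges T. of_bool (v \<in> e) * (f e)\<^sup>2)) / n - (1 + 2 / n) * H"
    unfolding quadratic_form_attach by (simp add: f_def g_def s_def G_def H_def n_def)
  also have "\<dots> \<le> ?mu * F + (s + G)\<^sup>2 / n - H"
  proof -
    have "eigenvalue (matrix_on (edges T) (reduced_entry T v))
        (lambda_max (matrix_on (edges T) (reduced_entry T v)))"
      by (intro lambda_max_is_eigenvalue_of_symmetric finite_edges ne reduced_entry_commute)
    then have "lambda_max (matrix_on (edges T) (reduced_entry T v)) \<le> ?mu"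
      using eigenvalue_limit_of_reduced eigenvalue_le_lambda_max_limit by blast
    then have "lambda_max (matrix_on (edges T) (reduced_entry T v)) * F \<le> ?mu * F"
      using FH by (intro mult_right_mono)
    moreover have "(\<Sum>e\<in>edges T. \<Sum>e'\<in>edges T. reduced_entry T v e e' * f e * f e') \<le>
        lambda_max (matrix_on (edges T) (reduced_entry T v)) * F"
      unfolding F_def by (intro quadratic_form_le_lambda_max finite_edges ne reduced_entry_commute)
    moreover have "((s + G)\<^sup>2 - 2 * (\<Sum>e\<in>edges T. of_bool (v \<in> e) * (f e)\<^sup>2)) / n \<le> (s + G)\<^sup>2 / n"
      using n by (intro divide_right_mono) (auto intro!: sum_nonneg)
    moreover have "(1 + 2 / n) * H \<ge> H"
      using n FH by (simp add: algebra_simps)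
    ultimately show ?thesis by linarith
  qed
  also have "(s + G)\<^sup>2 / n \<le> (1 + 1 / \<epsilon>) * D / n * F + (1 + \<epsilon>) * H"
  proof -
    \<comment> \<open>Weighted arithmetic-geometric mean inequality for the cross term 2 s G: the
      large weight falls on s, which involves only a fixed number of edges.\<close>
    have "0 \<le> (s - \<epsilon> * G)\<^sup>2 / \<epsilon>" using eps by simp
    also have "\<dots> = s\<^sup>2 / \<epsilon> + \<epsilon> * G\<^sup>2 - 2 * s * G"
      using eps by (simp add: power2_eq_square field_simps)
    finally have "(s + G)\<^sup>2 \<le> (1 + 1 / \<epsilon>) * s\<^sup>2 + (1 + \<epsilon>) * G\<^sup>2"
      by (simp add: power2_eq_square algebra_simps)
    moreover have "s\<^sup>2 \<le> D * F"
    proof -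
      \<comment> \<open>Cauchy-Schwarz over all old edges; the crude factor \<open>D\<close> does
        not depend on k.\<close>
      have "s\<^sup>2 \<le> D * (\<Sum>e\<in>edges T. (of_bool (v \<in> e) * f e)\<^sup>2)"
        unfolding s_def D_def using sum_squared_le_sum_of_squares[of _ "edges T"] by (simp add: mult.commute)
      also have "\<dots> \<le> D * F"
        unfolding F_def using FH by (intro mult_left_mono sum_mono) auto
      finally show ?thesis .
    qed
    moreover have "G\<^sup>2 \<le> n * H"
    proof -
      have "G\<^sup>2 \<le> real k * H"
        unfolding G_def H_def using sum_squared_le_sum_of_squares[of g "{..<k}"] by (simp add: mult.commute)
      \<comment> \<open>This factor n cancels the division by n. It leaves (1 + \<epsilon>) H, whose
        leading H is absorbed by the term -H of the form.\<close>
      also have "\<dots> \<le> n * H" using n FH by (intro mult_right_mono)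
      finally show ?thesis .
    qed
    ultimately have "(s + G)\<^sup>2 \<le> (1 + 1 / \<epsilon>) * (D * F) + (1 + \<epsilon>) * (n * H)"
      using eps by (smt (verit) mult_left_mono divide_nonneg_nonneg)
    then have "(s + G)\<^sup>2 / n \<le> ((1 + 1 / \<epsilon>) * (D * F) + (1 + \<epsilon>) * (n * H)) / n"
      using n by (intro divide_right_mono) auto
    also have "\<dots> = (1 + 1 / \<epsilon>) * D / n * F + (1 + \<epsilon>) * H"
      using n by (simp add: add_divide_distrib)
    finally show ?thesis .
  qed
  finally have "?lk * (F + H) \<le> (?mu + (1 + 1 / \<epsilon>) * D / n) * F + \<epsilon> * H"
    by (simp add: algebra_simps)
  \<comment> \<open>Both coefficients are raised to a common value. For that of \<open>H\<close>
    this uses that the limit eigenvalue is nonnegative, which the extra index guarantees.\<close>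
  also have "\<dots> \<le> (?mu + \<epsilon> + (1 + 1 / \<epsilon>) * D / n) * F + (?mu + \<epsilon> + (1 + 1 / \<epsilon>) * D / n) * H"
    using FH eps n lambda_max_limit_nonneg by (intro add_mono mult_right_mono) auto
  also have "\<dots> = (?mu + \<epsilon> + (1 + 1 / \<epsilon>) * D / n) * (F + H)"
    by (simp add: distrib_left)
  finally show ?thesis using pos by (simp add: D_def n_def)
qed

lemma lambda_max_attach_tendsto:
  assumes ne: "edges T \<noteq> {}"
  shows "(\<lambda>k. lambda_max (ricci_matrix (attach_pendants T v k)))
    \<longlonglongrightarrow> lambda_max (limit_matrix T v)"
proof (rule tendsto_sandwich)
  let ?mu = "lambda_max (limit_matrix T v)"
  define d where "d = real (degree T v)"
  define D where "D = real (card (edges T))"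
  have "d \<ge> 0" by (simp add: d_def)
  show "\<forall>\<^sub>F k in sequentially. ?mu - (real (degree T v) + 2) / (real (degree T v) + real k) \<le>
      lambda_max (ricci_matrix (attach_pendants T v k))"
    using eventually_gt_at_top[of 0] by eventually_elim (rule lambda_max_attach_lower)
  \<comment> \<open>With \<epsilon> = 1 / sqrt k the last term is (1 + sqrt k) D / (d + k), so both
    errors are of order at most 1 / sqrt k.\<close>
  show "\<forall>\<^sub>F k in sequentially. lambda_max (ricci_matrix (attach_pendants T v k)) \<le>
      ?mu + 1 / sqrt (real k) + (1 + 1 / (1 / sqrt (real k))) * real (card (edges T)) /
        (real (degree T v) + real k)"
    using eventually_gt_at_top[of 0] by eventually_elim (rule lambda_max_attach_upper[OF _ ne]; simp)
  show "(\<lambda>k. ?mu - (real (degree T v) + 2) / (real (degree T v) + real k)) \<longlonglongrightarrow> ?mu"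
    by real_asymp
  show "(\<lambda>k. ?mu + 1 / sqrt (real k) + (1 + 1 / (1 / sqrt (real k))) * real (card (edges T)) /
        (real (degree T v) + real k)) \<longlonglongrightarrow> ?mu"
    by real_asymp
qed

end

theorem proposition3:
  fixes T :: "'a ugraph" and v :: 'a
  assumes "finite_tree T"
    and "edges T \<noteq> {}"
    and "v \<in> verts T"
  shows "real_spectrum (limit_matrix T v) \<and>
    (\<lambda>k. lambda_max (ricci_matrix (attach_pendants T v k)))
      \<longlonglongrightarrow> lambda_max (limit_matrix T v) \<and>
    lambda_max (limit_matrix T v) =
      Max (insert 0 ((\<lambda>u. lambda_max (branch_matrix T v u)) ` neighbors T v))"
proof -
  interpret rooted_tree T v by standard (use assms in auto)
  show ?thesis
    using real_spectrum_limit lambda_max_attach_tendsto[OF assms(2)] lambda_max_limit_eq_Max by blast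
qed

end
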